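(* (a) Let $\mathfrak{q}$ be a Leibniz algebra over $\mathbb{K}$ and let $\mathfrak{m}=\mathfrak{m}_0\trianglelefteq\mathfrak{m}_1\trianglelefteq\dots\trianglelefteq\mathfrak{m}_{j-1}\trianglelefteq\mathfrak{m}_j=\mathfrak{q}$ be a $\mathrm{Lie}$-abelian series from $\mathfrak{m}$ to $\mathfrak{q}$. Then $\mathfrak{q}^{(i)}\subseteq\mathfrak{m}_{j-i}$ for $0\le i\le j$. (b) Let $k\geq 1$. A Leibniz algebra $\mathfrak{q}$ is $\mathrm{Lie}$-solvable with class of $\mathrm{Lie}$-solvability $k$ if and only if $\mathfrak{q}^{(k)}=0$ and $\mathfrak{q}^{(k-1)}\ne0$.
   Context: $\mathbb{K}$ is a field with $\frac12\in\mathbb{K}$. A Leibniz algebra is a $\mathbb{K}$-vector space with a bilinear bracket satisfying $[x,[y,z]]=[[x,y],z]-[[x,z],y]$. For two-sided ideals $\mathfrak{m},\mathfrak{n}$ of $\mathfrak{q}$, $[\mathfrak{m},\mathfrak{n}]_{\mathrm{Lie}}$ is the span of all $[m,n]+[n,m]$, $m\in\mathfrak{m}$, $n\in\mathfrak{n}$ (a two-sided ideal of $\mathfrak{q}$). A series from a two-sided ideal $\mathfrak{m}$ to $\mathfrak{q}$ of length $k$ is a finite chain $\mathfrak{m}=\mathfrak{m}_0\trianglelefteq\mathfrak{m}_1\trianglelefteq\dots\trianglelefteq\mathfrak{m}_k=\mathfrak{q}$ of two-sided ideals $\mathfrak{m}_i$ of $\mathfrak{q}$; it is $\mathrm{Lie}$-abelian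 if $[\mathfrak{m}_i,\mathfrak{m}_i]_{\mathrm{Lie}}\subseteq\mathfrak{m}_{i-1}$ for $1\le i\le k$. A series of $\mathfrak{q}$ is a series from $0$ to $\mathfrak{q}$. $\mathfrak{q}$ is $\mathrm{Lie}$-solvable if it has a $\mathrm{Lie}$-abelian series; the minimal length of such a series is its class of $\mathrm{Lie}$-solvability. The $\mathrm{Lie}$-derived series is $\mathfrak{q}^{(0)}=\mathfrak{q}$, $\mathfrak{q}^{(i)}=[\mathfrak{q}^{(i-1)},\mathfrak{q}^{(i-1)}]_{\mathrm{Lie}}$ for $i\ge1$. *)

theory Defs
  imports Complex_Main
begin

locale leibniz_algebra = vector_space scale
  for scale :: "'k::field \<Rightarrow> 'q::ab_group_add \<Rightarrow> 'q"
    and bracket :: "'q \<Rightarrow> 'q \<Rightarrow> 'q" +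
  assumes linear_bracket_left: "Vector_Spaces.linear scale scale (\<lambda>x. bracket x y)"
    and linear_bracket_right: "Vector_Spaces.linear scale scale (\<lambda>y. bracket x y)"
    and leibniz: "bracket x (bracket y z) = bracket (bracket x y) z - bracket (bracket x z) y"
begin

definition two_sided_ideal :: "'q set \<Rightarrow> bool" where
  "two_sided_ideal I \<longleftrightarrow>
     subspace I \<and> (\<forall>x\<in>I. \<forall>y. bracket x y \<in> I \<and> bracket y x \<in> I)"

definition lie_commutator :: "'q set \<Rightarrow> 'q set \<Rightarrow> 'q set" where
  "lie_commutator M N = span {bracket m n + bracket n m | m n. m \<in> M \<and> n \<in> N}"

(* Only the values s 0, ..., s k matter. Since all terms are two-sided ideals of the
   whole algebra, inclusion already makes s i a two-sided ideal of s (Suc i). *)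
definition series_from :: "'q set \<Rightarrow> (nat \<Rightarrow> 'q set) \<Rightarrow> nat \<Rightarrow> bool" where
  "series_from M s k \<longleftrightarrow>
     s 0 = M \<and> s k = UNIV \<and> (\<forall>i\<le>k. two_sided_ideal (s i)) \<and> (\<forall>i<k. s i \<subseteq> s (Suc i))"

definition lie_abelian_series_from :: "'q set \<Rightarrow> (nat \<Rightarrow> 'q set) \<Rightarrow> nat \<Rightarrow> bool" where
  "lie_abelian_series_from M s k \<longleftrightarrow>
     series_from M s k \<and> (\<forall>i\<in>{1..k}. lie_commutator (s i) (s i) \<subseteq> s (i - 1))"

definition lie_solvable :: bool where
  "lie_solvable \<longleftrightarrow> (\<exists>s k. lie_abelian_series_from {0} s k)"

(* Meaningful only if lie_solvable holds; otherwise LEAST is unspecified. *)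
definition lie_solvability_class :: nat where
  "lie_solvability_class = (LEAST k. \<exists>s. lie_abelian_series_from {0} s k)"

primrec lie_derived :: "nat \<Rightarrow> 'q set" where
  "lie_derived 0 = UNIV"
| "lie_derived (Suc i) = lie_commutator (lie_derived i) (lie_derived i)"

end

end

theory Submission
  imports Defs
begin

text \<open>
  Write \<open>x \<circ> y\<close> for the symmetrized bracket \<open>[x,y] + [y,x]\<close>. The Leibniz identity says two things
  about it: right multiplication is a derivation of the bracket, hence of \<open>\<circ>\<close>, and left
  multiplication annihilates every \<open>m \<circ> n\<close>. Therefore the Lie-commutator of two ideals is again an
  ideal (\<open>two_sided_ideal_lie_commutator\<close>), and the Lie-derived series is a descending chain of
  ideals, which, read upwards from a vanishing term, is itself a Lie-abelian series.

  Conversely the Lie-derived series descends at least as fast as any Lie-abelian series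
  (\<open>lie_derived_subset_series\<close>): each term of such a series contains the Lie-commutator of the
  term above it, and the Lie-commutator is monotone. Together, a Lie-abelian series of length \<open>k\<close>
  from \<open>0\<close> exists exactly when the \<open>k\<close>-th Lie-derived term vanishes
  (\<open>ex_lie_abelian_series_iff\<close>). The class of Lie-solvability is thus the first index at which the
  descending Lie-derived series reaches \<open>0\<close>.
\<close>

context leibniz_algebra
begin

lemma bracket_add_left: "bracket (x + y) z = bracket x z + bracket y z"
  using linear_bracket_left[of z] unfolding linear_iff_module_hom by (rule module_hom.add)

lemma bracket_add_right: "bracket x (y + z) = bracket x y + bracket x z"
  using linear_bracket_right[of x] unfolding linear_iff_module_hom by (rule module_hom.add)

text \<open>
  On the spanning elements \<open>m \<circ> n\<close>, the derivation property gives
  \<open>[m \<circ> n, z] = [m,z] \<circ> n + m \<circ> [n,z]\<close>, while in \<open>[z, m \<circ> n]\<close> the two expansions by the Leibniz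
  identity cancel. Both conditions on an element are linear, so they pass to the span.
\<close>

lemma two_sided_ideal_lie_commutator:
  assumes M: "two_sided_ideal M" and N: "two_sided_ideal N"
  shows "two_sided_ideal (lie_commutator M N)"
proof -
  define G where "G = {bracket m n + bracket n m | m n. m \<in> M \<and> n \<in> N}"
  have right: "bracket x y \<in> span G" if "x \<in> span G" for x y
  proof -
    have "subspace ((\<lambda>x. bracket x y) -` span G)"
      using linear_bracket_left[of y]
      by (simp add: linear_iff_module_hom module_hom.subspace_vimage)
    moreover have "G \<subseteq> (\<lambda>x. bracket x y) -` span G"
    proof
      fix g assume "g \<in> G"
      then obtain m n where g: "g = bracket m n + bracket n m" and m: "m \<in> M" and n: "n \<in> N"
        by (auto simp: G_def)
      have "bracket m y \<in> M" and "bracket n y \<in> N"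
        using M N m n by (auto simp: two_sided_ideal_def)
      then have "bracket (bracket m y) n + bracket n (bracket m y) \<in> G"
        and "bracket m (bracket n y) + bracket (bracket n y) m \<in> G"
        using m n by (auto simp: G_def)
      moreover have "bracket g y = (bracket (bracket m y) n + bracket n (bracket m y))
                                 + (bracket m (bracket n y) + bracket (bracket n y) m)"
        by (simp add: g bracket_add_left leibniz[of m n y] leibniz[of n m y])
      ultimately show "g \<in> (\<lambda>x. bracket x y) -` span G"
        by (simp add: span_add span_base)
    qed
    ultimately show ?thesis
      using that span_minimal by blast
  qed
  have left: "bracket y x \<in> span G" if "x \<in> span G" for x y
  proof -
    have "subspace (bracket y -` span G)"
      using linear_bracket_right[of y]
      by (simp add: linear_iff_module_hom module_hom.subspace_vimage)
    moreover have "G \<subseteq> bracket y -` span G"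
    proof
      fix g assume "g \<in> G"
      then obtain m n where g: "g = bracket m n + bracket n m"
        by (auto simp: G_def)
      have "bracket y g = 0"
        by (simp add: g bracket_add_right leibniz)
      then show "g \<in> bracket y -` span G"
        by (simp add: span_zero)
    qed
    ultimately show ?thesis
      using that span_minimal by blast
  qed
  show ?thesis
    using right left by (simp add: two_sided_ideal_def lie_commutator_def flip: G_def)
qed

lemma lie_commutator_mono:
  assumes "M \<subseteq> M'" and "N \<subseteq> N'"
  shows "lie_commutator M N \<subseteq> lie_commutator M' N'"
  unfolding lie_commutator_def using assms by (intro span_mono) blast

lemma lie_commutator_subset_ideal:
  assumes "two_sided_ideal M"
  shows "lie_commutator M N \<subseteq> M"
  unfolding lie_commutator_def
  using assms by (intro span_minimal) (auto simp: two_sided_ideal_def intro: subspace_add)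

lemma two_sided_ideal_lie_derived: "two_sided_ideal (lie_derived i)"
proof (induction i)
  case 0
  show ?case by (simp add: two_sided_ideal_def)
next
  case (Suc i)
  then show ?case by (simp add: two_sided_ideal_lie_commutator)
qed

lemma lie_derived_antimono: "i \<le> j \<Longrightarrow> lie_derived j \<subseteq> lie_derived i"
  by (rule lift_Suc_antimono_le)
    (simp_all add: lie_commutator_subset_ideal two_sided_ideal_lie_derived)

text \<open>
  By induction on the distance \<open>i\<close> from the top of the series: the next Lie-derived term is
  the Lie-commutator of one contained in \<open>s (j - i)\<close>, and by Lie-abelianness \<open>s (j - i - 1)\<close>
  contains the Lie-commutator of all of \<open>s (j - i)\<close>.
\<close>

lemma lie_derived_subset_series:
  assumes "lie_abelian_series_from M s j" and "i \<le> j"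
  shows "lie_derived i \<subseteq> s (j - i)"
  using \<open>i \<le> j\<close>
proof (induction i)
  case 0
  show ?case
    using assms(1) by (simp add: lie_abelian_series_from_def series_from_def)
next
  case (Suc i)
  have "lie_derived (Suc i) \<subseteq> lie_commutator (s (j - i)) (s (j - i))"
    using Suc by (simp add: lie_commutator_mono)
  also have "\<dots> \<subseteq> s (j - i - 1)"
  proof -
    have "j - i \<in> {1..j}"
      using Suc.prems by simp
    then show ?thesis
      using assms(1) unfolding lie_abelian_series_from_def by blast
  qed
  finally show ?case by simp
qed

lemma lie_abelian_series_lie_derived:
  "lie_abelian_series_from (lie_derived k) (\<lambda>i. lie_derived (k - i)) k"
proof -
  have "lie_commutator (lie_derived (k - i)) (lie_derived (k - i)) \<subseteq> lie_derived (k - (i - 1))"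
    if "i \<in> {1..k}" for i
  proof -
    have "k - (i - 1) = Suc (k - i)"
      using that by auto
    then show ?thesis by simp
  qed
  then show ?thesis
    by (simp add: lie_abelian_series_from_def series_from_def two_sided_ideal_lie_derived
        lie_derived_antimono)
qed

text \<open>
  The Lie-derived series is the fastest descending Lie-abelian series, so it alone decides whether
  a Lie-abelian series of a given length can reach \<open>0\<close>.
\<close>

lemma ex_lie_abelian_series_iff:
  "(\<exists>s. lie_abelian_series_from {0} s k) \<longleftrightarrow> lie_derived k = {0}"
proof
  assume "\<exists>s. lie_abelian_series_from {0} s k"
  then obtain s where s: "lie_abelian_series_from {0} s k" ..
  have "lie_derived k \<subseteq> {0}"
    using lie_derived_subset_series[OF s order_refl] s
    by (simp add: lie_abelian_series_from_def series_from_def)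
  moreover have "0 \<in> lie_derived k"
    using two_sided_ideal_lie_derived[of k] by (simp add: two_sided_ideal_def subspace_0)
  ultimately show "lie_derived k = {0}" by blast
next
  assume "lie_derived k = {0}"
  then show "\<exists>s. lie_abelian_series_from {0} s k"
    using lie_abelian_series_lie_derived[of k] by auto
qed

lemma lie_derived_eq_zero_mono:
  assumes "lie_derived i = {0}" and "i \<le> j"
  shows "lie_derived j = {0}"
  using lie_derived_antimono[OF assms(2)] assms(1) two_sided_ideal_lie_derived[of j]
  by (auto simp: two_sided_ideal_def dest: subspace_0)

lemma lie_solvable_iff: "lie_solvable \<longleftrightarrow> (\<exists>k. lie_derived k = {0})"
  unfolding lie_solvable_def using ex_lie_abelian_series_iff by blast

lemma lie_solvability_class_eq: "lie_solvability_class = (LEAST k. lie_derived k = {0})"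
  by (simp add: lie_solvability_class_def ex_lie_abelian_series_iff)

lemma lie_solvability_class_eq_iff:
  assumes "k \<ge> 1"
  shows "lie_solvable \<and> lie_solvability_class = k \<longleftrightarrow>
         lie_derived k = {0} \<and> lie_derived (k - 1) \<noteq> {0}"
proof
  assume "lie_solvable \<and> lie_solvability_class = k"
  then have ex: "\<exists>k. lie_derived k = {0}" and k: "k = (LEAST k. lie_derived k = {0})"
    by (auto simp: lie_solvable_iff lie_solvability_class_eq)
  have "lie_derived k = {0}"
    unfolding k using ex by (rule LeastI_ex)
  moreover have "lie_derived (k - 1) \<noteq> {0}"
    using assms not_less_Least[of "k - 1" "\<lambda>k. lie_derived k = {0}"] by (simp flip: k)
  ultimately show "lie_derived k = {0} \<and> lie_derived (k - 1) \<noteq> {0}" ..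
next
  assume R: "lie_derived k = {0} \<and> lie_derived (k - 1) \<noteq> {0}"
  have "k \<le> l" if "lie_derived l = {0}" for l
  proof (rule ccontr)
    assume "\<not> k \<le> l"
    then have "l \<le> k - 1" by simp
    with that R show False using lie_derived_eq_zero_mono by blast
  qed
  with R have "(LEAST k. lie_derived k = {0}) = k"
    by (intro Least_equality) auto
  with R show "lie_solvable \<and> lie_solvability_class = k"
    by (auto simp: lie_solvable_iff lie_solvability_class_eq)
qed

end

theorem theorem5p4:
  fixes scale :: "'k::field \<Rightarrow> 'q::ab_group_add \<Rightarrow> 'q"
    and bracket :: "'q \<Rightarrow> 'q \<Rightarrow> 'q"
  assumes two_nonzero: "(2::'k) \<noteq> 0"
    and leibniz: "leibniz_algebra scale bracket"
  shows "(\<forall>M s j. leibniz_algebra.lie_abelian_series_from scale bracket M s j \<longrightarrow>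
            (\<forall>i\<le>j. leibniz_algebra.lie_derived scale bracket i \<subseteq> s (j - i))) \<and>
         (\<forall>k::nat. k \<ge> 1 \<longrightarrow>
            (leibniz_algebra.lie_solvable scale bracket \<and>
             leibniz_algebra.lie_solvability_class scale bracket = k
             \<longleftrightarrow>
             leibniz_algebra.lie_derived scale bracket k = {0} \<and>
             leibniz_algebra.lie_derived scale bracket (k - 1) \<noteq> {0}))"
  using leibniz_algebra.lie_derived_subset_series[OF leibniz]
    leibniz_algebra.lie_solvability_class_eq_iff[OF leibniz]
  by blast

end
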